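(* Let $(\mathcal{X},\tau,\mathcal{B})$ be an effective topological space and $A\subseteq X_c$. Then $A$ is Markov-semidecidable if and only if $A$ is K-semidecidable. The equivalence is uniform: from an index of a machine witnessing one property one can compute an index of a machine witnessing the other.
   Context: Let $(\varphi_e)_{e\in\mathbb{N}}$ be a standard effective enumeration of the partial computable functions on $\mathbb{N}$, and $W_e=\mathrm{dom}(\varphi_e)$. An effective topological space is a triple $(\mathcal{X},\tau,\mathcal{B})$ where $(\mathcal{X},\tau)$ is a non-empty topological space and $\mathcal{B}=(\mathcal{B}_i)_{i\in\mathbb{N}}$ is a numbered basis of $\tau$ such that there is a total computable $f$ with $\mathcal{B}_i\cap\mathcal{B}_j=\bigcup_{k\in W_{f(i,j)}}\mathcal{B}_k$. A Type-2 name of $x\in\mathcal{X}$ is any $p\in\mathbb{N}^{\mathbb{N}}$ with $\{p(n):n\in\mathbb{N}\}=\{i:x\in\mathcal{B}_i\}$. $X_c$ is the set of points having a computable Type-2 name. A Markov name of $x\in X_c$ is any $e$ such that $\varphi_e$ is total and is a Type-2 name of $x$. $K(x)$, for $x\in X_c$, is the length of a shortest program computing a Type-2 name of $x$. A K-name of $x\in X_c$ is a pair $(k,p)$ with $k\geq K(x)$ and $p$ a Type-2 name of $x$. A set $A\subseteq X_c$ is Markov-semidecidable (resp. K-semidecidable) if there is a Turing machine which, given any Markov name (resp. any K-name, with $k$ as input and $p$ as oracle) of any $x\in X_c$, halts if and only if $x\in A$. *)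

theory Defs
  imports "HOL-Analysis.Abstract_Topology" "HOL-Library.Nat_Bijection"
begin

text \<open>
  Programs denote unary partial recursive functions relative to an oracle in
  \<open>\<nat>\<^sup>\<nat>\<close>; several arguments are passed through the Cantor pairing
  \<^const>\<open>prod_encode\<close>. The schemes are Kleene's: zero, successor, projections, pairing,
  composition, primitive recursion and unbounded minimisation, plus a call of the oracle.
  The identity is \<open>CPair CFst CSnd\<close>.
\<close>

datatype prog =
    CZero | CSucc | CFst | CSnd | COracle
  | CPair prog prog | CComp prog prog | CPrec prog prog | CMu prog

primrec eval :: "(nat \<Rightarrow> nat) \<Rightarrow> prog \<Rightarrow> nat \<Rightarrow> nat option" where
  "eval p CZero = (\<lambda>n. Some 0)"
| "eval p CSucc = (\<lambda>n. Some (Suc n))"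
| "eval p CFst = (\<lambda>n. Some (fst (prod_decode n)))"
| "eval p CSnd = (\<lambda>n. Some (snd (prod_decode n)))"
| "eval p COracle = (\<lambda>n. Some (p n))"
| "eval p (CPair c d) = (\<lambda>n.
     Option.bind (eval p c n) (\<lambda>a.
     Option.bind (eval p d n) (\<lambda>b. Some (prod_encode (a, b)))))"
| "eval p (CComp c d) = (\<lambda>n. Option.bind (eval p d n) (eval p c))"
| "eval p (CPrec c d) = (\<lambda>n.
     case prod_decode n of (a, m) \<Rightarrow>
       rec_nat (eval p c a)
         (\<lambda>i r. Option.bind r (\<lambda>y. eval p d (prod_encode (a, prod_encode (i, y))))) m)"
| "eval p (CMu c) = (\<lambda>a.
     let zero_at = (\<lambda>n. eval p c (prod_encode (a, n)) = Some 0 \<and>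
                        (\<forall>i<n. eval p c (prod_encode (a, i)) \<noteq> None))
     in if \<exists>n. zero_at n then Some (LEAST n. zero_at n) else None)"

text \<open>The Goedel numbering of programs, a bijection between \<open>\<nat>\<close> and \<^typ>\<open>prog\<close>.\<close>

function (sequential) prog_of :: "nat \<Rightarrow> prog" where
  "prog_of n =
    (if n = 0 then CZero else if n = 1 then CSucc else if n = 2 then CFst
     else if n = 3 then CSnd else if n = 4 then COracle
     else let q = (n - 5) div 4; a = fst (prod_decode q); b = snd (prod_decode q) in
       if (n - 5) mod 4 = 0 then CPair (prog_of a) (prog_of b)
       else if (n - 5) mod 4 = 1 then CComp (prog_of a) (prog_of b)
       else if (n - 5) mod 4 = 2 then CPrec (prog_of a) (prog_of b)
       else CMu (prog_of q))"
  by pat_completeness auto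

lemma prod_decode_le:
  "fst (prod_decode q) \<le> q" "snd (prod_decode q) \<le> q"
  by (metis le_prod_encode_1 prod.collapse prod_decode_inverse)
     (metis le_prod_encode_2 prod.collapse prod_decode_inverse)

termination prog_of
proof (relation "measure id", goal_cases)
  case 1 show ?case by simp
qed (use prod_decode_le in \<open>fastforce intro: le_less_trans simp: le_less_trans[OF div_le_dividend]
       intro!: le_less_trans[OF prod_decode_le(1)] le_less_trans[OF prod_decode_le(2)]\<close>)+

declare prog_of.simps [simp del]

primrec code_of :: "prog \<Rightarrow> nat" where
  "code_of CZero = 0"
| "code_of CSucc = 1"
| "code_of CFst = 2"
| "code_of CSnd = 3"
| "code_of COracle = 4"
| "code_of (CPair c d) = 4 * prod_encode (code_of c, code_of d) + 5"
| "code_of (CComp c d) = 4 * prod_encode (code_of c, code_of d) + 6"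
| "code_of (CPrec c d) = 4 * prod_encode (code_of c, code_of d) + 7"
| "code_of (CMu c) = 4 * code_of c + 8"

lemma prog_of_compound:
  "prog_of (4 * q + 5) = CPair (prog_of (fst (prod_decode q))) (prog_of (snd (prod_decode q)))"
  "prog_of (4 * q + 6) = CComp (prog_of (fst (prod_decode q))) (prog_of (snd (prod_decode q)))"
  "prog_of (4 * q + 7) = CPrec (prog_of (fst (prod_decode q))) (prog_of (snd (prod_decode q)))"
  "prog_of (4 * q + 8) = CMu (prog_of q)"
proof -
  have "(4 * q + r + 5 - 5) div 4 = q" "(4 * q + r + 5 - 5) mod 4 = r" if "r < 4" for r
    using that by auto
  from this[of 0] this[of 1] this[of 2] this[of 3]
  have *: "(4 * q + 5 - 5) div 4 = q" "(4 * q + 5 - 5) mod 4 = 0"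
    "(4 * q + 6 - 5) div 4 = q" "(4 * q + 6 - 5) mod 4 = 1"
    "(4 * q + 7 - 5) div 4 = q" "(4 * q + 7 - 5) mod 4 = 2"
    "(4 * q + 8 - 5) div 4 = q" "(4 * q + 8 - 5) mod 4 = 3"
    by simp_all
  show "prog_of (4 * q + 5) = CPair (prog_of (fst (prod_decode q))) (prog_of (snd (prod_decode q)))"
    "prog_of (4 * q + 6) = CComp (prog_of (fst (prod_decode q))) (prog_of (snd (prod_decode q)))"
    "prog_of (4 * q + 7) = CPrec (prog_of (fst (prod_decode q))) (prog_of (snd (prod_decode q)))"
    "prog_of (4 * q + 8) = CMu (prog_of q)"
    by (subst prog_of.simps, unfold * Let_def, simp)+
qed

lemma prog_of_code_of: "prog_of (code_of c) = c"
  by (induction c)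
     (simp_all only: code_of.simps prog_of_compound prod_encode_inverse fst_conv snd_conv,
      simp_all add: prog_of.simps)

lemma code_of_prog_of: "code_of (prog_of n) = n"
proof (induction n rule: less_induct)
  case (less n)
  show ?case
  proof (cases "n < 5")
    case True
    then have "n \<in> {0, 1, 2, 3, 4}" by auto
    then show ?thesis by (auto simp: prog_of.simps[of n])
  next
    case False
    define q where "q = (n - 5) div 4"
    have q: "q < n" using False by (simp add: q_def)
    have ih: "code_of (prog_of (fst (prod_decode q))) = fst (prod_decode q)"
      "code_of (prog_of (snd (prod_decode q))) = snd (prod_decode q)"
      "code_of (prog_of q) = q"
      using less q prod_decode_le[of q] le_less_trans by blast+
    have n: "n = 4 * q + (n - 5) mod 4 + 5"
      using False by (simp add: q_def)
    have "(n - 5) mod 4 \<in> {0, 1, 2, 3}" by auto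
    then show ?thesis
      using False ih n by (auto simp: prog_of.simps[of n] Let_def q_def[symmetric])
  qed
qed

text \<open>\<open>Phi p e\<close> is the partial function computed by the \<open>e\<close>-th machine with oracle
  \<open>p\<close>; the oracle-free enumeration is obtained by a trivial oracle.\<close>

definition Phi :: "(nat \<Rightarrow> nat) \<Rightarrow> nat \<Rightarrow> nat \<Rightarrow> nat option" where
  "Phi p e = eval p (prog_of e)"

definition phi :: "nat \<Rightarrow> nat \<Rightarrow> nat option" where
  "phi e = Phi (\<lambda>_. 0) e"

definition W :: "nat \<Rightarrow> nat set" where
  "W e = dom (phi e)"

definition total_computable :: "(nat \<Rightarrow> nat) \<Rightarrow> bool" where
  "total_computable f \<longleftrightarrow> (\<exists>e. \<forall>n. phi e n = Some (f n))"

definition total_computable2 :: "(nat \<Rightarrow> nat \<Rightarrow> nat) \<Rightarrow> bool" where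
  "total_computable2 f \<longleftrightarrow> (\<exists>e. \<forall>i j. phi e (prod_encode (i, j)) = Some (f i j))"

text \<open>
  Binary programs are run by the usual additively optimal universal machine: the program
  \<open>0\<^sup>i 1 q\<close> runs the \<open>i\<close>-th machine with the string \<open>q\<close> as an extra
  input, so lengths of shortest programs are Kolmogorov complexities.
  Strings are identified with numbers by bijective base-2 notation.
\<close>

primrec string_code :: "bool list \<Rightarrow> nat" where
  "string_code [] = 0"
| "string_code (b # s) = 2 * string_code s + (if b then 2 else 1)"

definition run_string :: "bool list \<Rightarrow> nat \<Rightarrow> nat option" where
  "run_string s n =
    (case dropWhile Not s of
       [] \<Rightarrow> None
     | _ # q \<Rightarrow> phi (length (takeWhile Not s)) (prod_encode (string_code q, n)))"

definition numbered_basis :: "'a topology \<Rightarrow> (nat \<Rightarrow> 'a set) \<Rightarrow> bool" where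
  "numbered_basis T B \<longleftrightarrow>
     (\<forall>i. openin T (B i)) \<and> (\<forall>U. openin T U \<longrightarrow> (\<exists>I. U = (\<Union>i\<in>I. B i)))"

definition effective_topological_space :: "'a topology \<Rightarrow> (nat \<Rightarrow> 'a set) \<Rightarrow> bool" where
  "effective_topological_space T B \<longleftrightarrow>
     topspace T \<noteq> {} \<and> numbered_basis T B \<and>
     (\<exists>f. total_computable2 f \<and> (\<forall>i j. B i \<inter> B j = (\<Union>k\<in>W (f i j). B k)))"

definition type2_name :: "(nat \<Rightarrow> 'a set) \<Rightarrow> (nat \<Rightarrow> nat) \<Rightarrow> 'a \<Rightarrow> bool" where
  "type2_name B p x \<longleftrightarrow> range p = {i. x \<in> B i}"

definition computable_points :: "'a topology \<Rightarrow> (nat \<Rightarrow> 'a set) \<Rightarrow> 'a set" where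
  "computable_points T B = {x \<in> topspace T. \<exists>p. total_computable p \<and> type2_name B p x}"

definition markov_name :: "(nat \<Rightarrow> 'a set) \<Rightarrow> nat \<Rightarrow> 'a \<Rightarrow> bool" where
  "markov_name B e x \<longleftrightarrow> (\<exists>p. (\<forall>n. phi e n = Some (p n)) \<and> type2_name B p x)"

definition K :: "(nat \<Rightarrow> 'a set) \<Rightarrow> 'a \<Rightarrow> nat" where
  "K B x = (LEAST l. \<exists>s p. length s = l \<and> (\<forall>n. run_string s n = Some (p n)) \<and> type2_name B p x)"

definition K_name :: "(nat \<Rightarrow> 'a set) \<Rightarrow> nat \<times> (nat \<Rightarrow> nat) \<Rightarrow> 'a \<Rightarrow> bool" where
  "K_name B kp x \<longleftrightarrow> (case kp of (k, p) \<Rightarrow> k \<ge> K B x \<and> type2_name B p x)"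

definition markov_semidecides ::
    "'a topology \<Rightarrow> (nat \<Rightarrow> 'a set) \<Rightarrow> nat \<Rightarrow> 'a set \<Rightarrow> bool" where
  "markov_semidecides T B m A \<longleftrightarrow>
     (\<forall>x\<in>computable_points T B. \<forall>e. markov_name B e x \<longrightarrow> (phi m e \<noteq> None \<longleftrightarrow> x \<in> A))"

definition K_semidecides ::
    "'a topology \<Rightarrow> (nat \<Rightarrow> 'a set) \<Rightarrow> nat \<Rightarrow> 'a set \<Rightarrow> bool" where
  "K_semidecides T B m A \<longleftrightarrow>
     (\<forall>x\<in>computable_points T B. \<forall>k p. K_name B (k, p) x \<longrightarrow> (Phi p m k \<noteq> None \<longleftrightarrow> x \<in> A))"

definition markov_semidecidable :: "'a topology \<Rightarrow> (nat \<Rightarrow> 'a set) \<Rightarrow> 'a set \<Rightarrow> bool" where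
  "markov_semidecidable T B A \<longleftrightarrow> (\<exists>m. markov_semidecides T B m A)"

definition K_semidecidable :: "'a topology \<Rightarrow> (nat \<Rightarrow> 'a set) \<Rightarrow> 'a set \<Rightarrow> bool" where
  "K_semidecidable T B A \<longleftrightarrow> (\<exists>m. K_semidecides T B m A)"

end

theory Submission imports Defs begin

text \<open>
  From a Markov name \<open>e\<close> of \<open>x\<close> one gets a K-name: \<open>e\<close> computes a Type-2 name, and an upper
  bound on \<open>K(x)\<close> is the length of an explicit program built from \<open>e\<close>.

  Conversely let \<open>m\<close> semidecide \<open>A\<close> on Markov names and let \<open>(k, p)\<close> be a K-name of \<open>x\<close>. By the
  recursion theorem there are programs \<open>e(i, j)\<close> that copy program \<open>i\<close> until \<open>m\<close> accepts \<open>e(i, j)\<close>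
  itself and list the range of program \<open>j\<close> afterwards. Accept \<open>x\<close> if for some \<open>i\<close> and all
  programs \<open>j\<close> of length at most \<open>k\<close>, \<open>m\<close> accepts \<open>e(i, j)\<close> and everything copied from \<open>i\<close>
  before that moment is listed by \<open>p\<close>.
  If \<open>x \<in> A\<close>, any \<open>i\<close> that names \<open>x\<close> works: were \<open>e(i, j)\<close> not accepted, it would be a Markov
  name of \<open>x\<close>. If the search succeeds, take \<open>j\<close> naming \<open>x\<close>: then \<open>e(i, j)\<close> is an accepted
  Markov name of \<open>x\<close>, hence \<open>x \<in> A\<close>.

  Computations are certified by finite sets of facts ``program \<open>e\<close> maps \<open>n\<close> to \<open>v\<close>'', each of
  which is justified by other facts of the set. Membership of a fact and validity of a set are
  decidable, which yields the universal machine and bounded-time halting.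
\<close>

section \<open>Total recursive functions and decidable predicates\<close>

definition recursive :: "((nat \<Rightarrow> nat) \<Rightarrow> nat \<Rightarrow> nat) \<Rightarrow> bool" where
  "recursive F \<longleftrightarrow> (\<exists>c. \<forall>p n. eval p c n = Some (F p n))"

text \<open>As for \<^const>\<open>CMu\<close>, the value 0 stands for truth.\<close>

definition decidable :: "((nat \<Rightarrow> nat) \<Rightarrow> nat \<Rightarrow> bool) \<Rightarrow> bool" where
  "decidable P \<longleftrightarrow> recursive (\<lambda>p n. if P p n then 0 else 1)"

named_theorems recursive_intros

lemma recursive_id [recursive_intros]: "recursive (\<lambda>p n. n)"
  unfolding recursive_def by (rule exI[of _ "CPair CFst CSnd"]) simp

lemma recursive_Suc [recursive_intros]: "recursive (\<lambda>p n. Suc (f p n))" if "recursive f"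
proof -
  from that obtain c where "\<forall>p n. eval p c n = Some (f p n)" unfolding recursive_def by blast
  then show ?thesis unfolding recursive_def by (intro exI[of _ "CComp CSucc c"]) simp
qed

lemma recursive_fst [recursive_intros]:
  "recursive (\<lambda>p n. fst (prod_decode (f p n)))" if "recursive f"
proof -
  from that obtain c where "\<forall>p n. eval p c n = Some (f p n)" unfolding recursive_def by blast
  then show ?thesis unfolding recursive_def by (intro exI[of _ "CComp CFst c"]) simp
qed

lemma recursive_snd [recursive_intros]:
  "recursive (\<lambda>p n. snd (prod_decode (f p n)))" if "recursive f"
proof -
  from that obtain c where "\<forall>p n. eval p c n = Some (f p n)" unfolding recursive_def by blast
  then show ?thesis unfolding recursive_def by (intro exI[of _ "CComp CSnd c"]) simp
qed

lemma recursive_oracle [recursive_intros]: "recursive (\<lambda>p n. p (f p n))" if "recursive f"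
proof -
  from that obtain c where "\<forall>p n. eval p c n = Some (f p n)" unfolding recursive_def by blast
  then show ?thesis unfolding recursive_def by (intro exI[of _ "CComp COracle c"]) simp
qed

lemma recursive_pair [recursive_intros]:
  "recursive (\<lambda>p n. prod_encode (f p n, g p n))" if "recursive f" "recursive g"
proof -
  from that obtain c d where "\<forall>p n. eval p c n = Some (f p n)" "\<forall>p n. eval p d n = Some (g p n)"
    unfolding recursive_def by blast
  then show ?thesis unfolding recursive_def by (intro exI[of _ "CPair c d"]) simp
qed

text \<open>Needed for parameters under a recursion or a bounded quantifier: there the original
  argument is one component of a coded tuple, so a given function has to be evaluated at a
  projection.\<close>

lemma recursive_compose: "recursive (\<lambda>p n. f p (g p n))" if "recursive f" "recursive g"
proof -
  from that obtain c d where "\<forall>p n. eval p c n = Some (f p n)" "\<forall>p n. eval p d n = Some (g p n)"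
    unfolding recursive_def by blast
  then show ?thesis unfolding recursive_def by (intro exI[of _ "CComp c d"]) simp
qed

lemma recursive_const [recursive_intros]: "recursive (\<lambda>p n. k)"
proof (induction k)
  case 0
  show ?case unfolding recursive_def by (rule exI[of _ CZero]) simp
qed (rule recursive_Suc)

text \<open>The whole input serves as the parameter of \<open>CPrec\<close>; hence \<open>h\<close>
  is required to be recursive on coded triples of input, counter and previous value.\<close>

lemma recursive_rec_nat:
  assumes "recursive f" "recursive b"
    and "recursive (\<lambda>p n. h p (fst (prod_decode n)) (fst (prod_decode (snd (prod_decode n))))
           (snd (prod_decode (snd (prod_decode n)))))"
  shows "recursive (\<lambda>p n. rec_nat (f p n) (h p n) (b p n))"
proof -
  from assms obtain c d e where c: "\<forall>p n. eval p c n = Some (f p n)"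
    and d: "\<forall>p n. eval p d n = Some (h p (fst (prod_decode n))
              (fst (prod_decode (snd (prod_decode n)))) (snd (prod_decode (snd (prod_decode n)))))"
    and e: "\<forall>p n. eval p e n = Some (b p n)"
    unfolding recursive_def by blast
  have "rec_nat (eval p c n)
      (\<lambda>i r. Option.bind r (\<lambda>y. eval p d (prod_encode (n, prod_encode (i, y))))) m
      = Some (rec_nat (f p n) (h p n) m)" for p n m
    by (induction m) (simp_all add: c d)
  then have "eval p (CComp (CPrec c d) (CPair (CPair CFst CSnd) e)) n
      = Some (rec_nat (f p n) (h p n) (b p n))" for p n
    by (simp add: e)
  then show ?thesis unfolding recursive_def by blast
qed

lemma recursive_add [recursive_intros]:
  assumes "recursive f" "recursive g"
  shows "recursive (\<lambda>p n. f p n + g p n)"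
proof -
  have "rec_nat a (\<lambda>i y. Suc y) b = a + b" for a b by (induction b) simp_all
  moreover have "recursive (\<lambda>p n. rec_nat (f p n) (\<lambda>i y. Suc y) (g p n))"
    by (intro recursive_rec_nat recursive_intros assms)
  ultimately show ?thesis by simp
qed

lemma recursive_diff [recursive_intros]:
  assumes "recursive f" "recursive g"
  shows "recursive (\<lambda>p n. f p n - g p n)"
proof -
  have pred: "rec_nat 0 (\<lambda>i y. i) b = b - 1" for b :: nat by (cases b) simp_all
  have "rec_nat a (\<lambda>i y. rec_nat 0 (\<lambda>i y. i) y) b = a - b" for a b :: nat
    by (induction b) (simp_all add: pred)
  moreover have "recursive (\<lambda>p n. rec_nat (f p n) (\<lambda>i y. rec_nat 0 (\<lambda>i y. i) y) (g p n))"
    by (intro recursive_rec_nat recursive_intros assms)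
  ultimately show ?thesis by simp
qed

lemma recursive_mult [recursive_intros]:
  assumes "recursive f" "recursive g"
  shows "recursive (\<lambda>p n. f p n * g p n)"
proof -
  have "rec_nat 0 (\<lambda>i y. y + a) b = a * b" for a b :: nat by (induction b) simp_all
  moreover have "recursive (\<lambda>p n. rec_nat 0 (\<lambda>i y. y + f p n) (g p n))"
    by (intro recursive_rec_nat recursive_intros assms recursive_compose[OF assms(1)])
  ultimately show ?thesis by simp
qed


section \<open>Decidable predicates and bounded quantifiers\<close>

lemma decidable_compose: "decidable (\<lambda>p n. P p (g p n))" if "decidable P" "recursive g"
  using recursive_compose[OF that[unfolded decidable_def]] unfolding decidable_def .

text \<open>Recursion over the truth value: 0 returns the base value \<open>f\<close>, while 1 makes
  a single step that discards the base value and returns \<open>g\<close>.\<close>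

lemma recursive_if [recursive_intros]:
  assumes "decidable P" "recursive f" "recursive g"
  shows "recursive (\<lambda>p n. if P p n then f p n else g p n)"
proof -
  have "recursive (\<lambda>p n. rec_nat (f p n) (\<lambda>i y. g p n) (if P p n then 0 else 1))"
    using assms(1) unfolding decidable_def
    by (intro recursive_rec_nat recursive_intros assms recursive_compose[OF assms(3)])
  moreover have "(\<lambda>p n. rec_nat (f p n) (\<lambda>i y. g p n) (if P p n then 0 else 1))
    = (\<lambda>p n. if P p n then f p n else g p n)"
    by (intro ext) simp
  ultimately show ?thesis by simp
qed

lemma decidable_eq_0: "decidable (\<lambda>p n. f p n = 0)" if "recursive f"
proof -
  \<comment> \<open>Truncated subtraction sends every positive value to 1.\<close>
  have "recursive (\<lambda>p n. 1 - (1 - f p n))" by (intro recursive_intros that)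
  moreover have "(\<lambda>p n. 1 - (1 - f p n)) = (\<lambda>p n. if f p n = 0 then 0 else 1)"
    by (intro ext) simp
  ultimately show ?thesis unfolding decidable_def by simp
qed

lemma decidable_le [recursive_intros]:
  "decidable (\<lambda>p n. f p n \<le> g p n)" if "recursive f" "recursive g"
  using decidable_eq_0[OF recursive_diff[OF that]] by simp

lemma decidable_less [recursive_intros]:
  "decidable (\<lambda>p n. f p n < g p n)" if "recursive f" "recursive g"
  using decidable_le[OF recursive_Suc[OF that(1)] that(2)] by (simp add: Suc_le_eq)

lemma decidable_conj [recursive_intros]:
  "decidable (\<lambda>p n. P p n \<and> Q p n)" if "decidable P" "decidable Q"
proof -
  have "recursive (\<lambda>p n. if P p n then if Q p n then 0 else 1 else 1)"
    by (intro recursive_intros that)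
  moreover have "(\<lambda>p n. if P p n then if Q p n then 0 else 1 else 1 :: nat)
    = (\<lambda>p n. if P p n \<and> Q p n then 0 else 1)" by (intro ext) simp
  ultimately show ?thesis unfolding decidable_def by simp
qed

lemma decidable_not [recursive_intros]: "decidable (\<lambda>p n. \<not> P p n)" if "decidable P"
proof -
  have "recursive (\<lambda>p n. if P p n then 1 else 0)" by (intro recursive_intros that)
  moreover have "(\<lambda>p n. if P p n then 1 else 0 :: nat) = (\<lambda>p n. if \<not> P p n then 0 else 1)"
    by (intro ext) simp
  ultimately show ?thesis unfolding decidable_def by simp
qed

lemma decidable_disj [recursive_intros]:
  "decidable (\<lambda>p n. P p n \<or> Q p n)" if "decidable P" "decidable Q"
  using decidable_not[OF decidable_conj[OF decidable_not decidable_not, OF that]] by simp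

lemma decidable_imp [recursive_intros]:
  "decidable (\<lambda>p n. P p n \<longrightarrow> Q p n)" if "decidable P" "decidable Q"
  using decidable_disj[OF decidable_not, OF that] by simp

lemma decidable_eq [recursive_intros]:
  "decidable (\<lambda>p n. f p n = g p n)" if "recursive f" "recursive g"
  using decidable_conj[OF decidable_le[OF that] decidable_le[OF that(2,1)]]
  by (simp only: eq_iff[where 'a = nat])

text \<open>The accumulator stays 0 until a counterexample sets it to 1, which no later step
  undoes.\<close>

lemma decidable_all_less [recursive_intros]:
  assumes "recursive b" "decidable (\<lambda>p n. P p (fst (prod_decode n)) (snd (prod_decode n)))"
  shows "decidable (\<lambda>p n. \<forall>i<b p n. P p n i)"
proof -
  have "recursive (\<lambda>p n. prod_encode (fst (prod_decode n), fst (prod_decode (snd (prod_decode n)))))"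
    by (intro recursive_intros)
  from decidable_compose[OF assms(2) this]
  have "decidable (\<lambda>p n. P p (fst (prod_decode n)) (fst (prod_decode (snd (prod_decode n)))))"
    by simp
  then have "recursive (\<lambda>p n. rec_nat 0 (\<lambda>i y. if P p n i then y else 1) (b p n))"
    by (intro recursive_rec_nat recursive_intros assms)
  moreover have "rec_nat 0 (\<lambda>i y. if Q i then y else 1) m = (if \<forall>i<m. Q i then 0 else 1 :: nat)"
    for Q m by (induction m) (auto simp: less_Suc_eq)
  ultimately show ?thesis unfolding decidable_def by simp
qed

lemma decidable_all_le [recursive_intros]:
  assumes "recursive b" "decidable (\<lambda>p n. P p (fst (prod_decode n)) (snd (prod_decode n)))"
  shows "decidable (\<lambda>p n. \<forall>i\<le>b p n. P p n i)"
  using decidable_all_less[OF recursive_Suc, OF assms] by (simp add: less_Suc_eq_le)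

lemma decidable_ex_le [recursive_intros]:
  assumes "recursive b" "decidable (\<lambda>p n. P p (fst (prod_decode n)) (snd (prod_decode n)))"
  shows "decidable (\<lambda>p n. \<exists>i\<le>b p n. P p n i)"
  using decidable_not[OF decidable_all_le[OF assms(1) decidable_not[OF assms(2)]]] by simp

lemma recursive_power2 [recursive_intros]: "recursive (\<lambda>p n. 2 ^ f p n)" if "recursive f"
proof -
  have "rec_nat 1 (\<lambda>i y. 2 * y) m = (2 ^ m :: nat)" for m by (induction m) simp_all
  moreover have "recursive (\<lambda>p n. rec_nat 1 (\<lambda>i y. 2 * y) (f p n))"
    by (intro recursive_rec_nat recursive_intros that)
  ultimately show ?thesis by simp
qed

lemma decidable_mem_set_decode [recursive_intros]:
  assumes "recursive f" "recursive g"
  shows "decidable (\<lambda>p n. f p n \<in> set_decode (g p n))"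
proof -
  \<comment> \<open>Bit \<open>x\<close> is set exactly when the quotient by \<open>2 ^ x\<close> is
    odd. Both the half quotient \<open>q\<close> and the remainder \<open>r\<close> are at most
    \<open>y\<close>, so bounded search replaces division.\<close>
  have mem: "x \<in> set_decode y \<longleftrightarrow> (\<exists>q\<le>y. \<exists>r\<le>y. y = 2 ^ x * (2 * q + 1) + r \<and> r < 2 ^ x)" for x y
  proof
    assume "x \<in> set_decode y"
    then have "odd (y div 2 ^ x)" by (simp add: set_decode_def)
    then have "y div 2 ^ x = 2 * (y div 2 ^ x div 2) + 1" by simp
    then have "y = 2 ^ x * (2 * (y div 2 ^ x div 2) + 1) + y mod 2 ^ x"
      using mult_div_mod_eq[of "2 ^ x" y] by simp
    moreover have "y div 2 ^ x div 2 \<le> y" by (meson div_le_dividend le_trans)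
    ultimately show "\<exists>q\<le>y. \<exists>r\<le>y. y = 2 ^ x * (2 * q + 1) + r \<and> r < 2 ^ x"
      by (intro exI[of _ "y div 2 ^ x div 2"] exI[of _ "y mod 2 ^ x"] conjI) simp_all
  next
    assume "\<exists>q\<le>y. \<exists>r\<le>y. y = 2 ^ x * (2 * q + 1) + r \<and> r < 2 ^ x"
    then obtain q r where "y = 2 ^ x * (2 * q + 1) + r" "r < 2 ^ x" by blast
    then have "y div 2 ^ x = 2 * q + 1"
      by (intro div_nat_eqI) (simp_all add: algebra_simps)
    then show "x \<in> set_decode y" by (simp add: set_decode_def)
  qed
  show ?thesis unfolding mem
    by (intro recursive_intros assms recursive_compose[OF assms(1)] recursive_compose[OF assms(2)])
qed

section \<open>Derivations\<close>

definition fact_code :: "nat \<Rightarrow> nat \<Rightarrow> nat \<Rightarrow> nat" where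
  "fact_code e n v = prod_encode (e, prod_encode (n, v))"

lemma recursive_fact_code [recursive_intros]:
  "recursive (\<lambda>p n. fact_code (f p n) (g p n) (h p n))"
  if "recursive f" "recursive g" "recursive h"
  unfolding fact_code_def by (intro recursive_intros that)

lemma mem_set_decode_less: "x \<in> set_decode y \<Longrightarrow> x < y"
proof -
  assume "x \<in> set_decode y"
  then have "2 ^ x \<le> y"
    by (cases "y < 2 ^ x") (auto simp: set_decode_def)
  with less_exp[of x] show "x < y" by (rule order.strict_trans2)
qed

text \<open>An element of a coded set is smaller than the code, and so are the components of the
  fact. This bounds the witnesses in \<open>justified\<close>.\<close>

lemma fact_code_bound: "v \<le> D" if "fact_code e n v \<in> set_decode D"
  using mem_set_decode_less[OF that] le_prod_encode_2[of "prod_encode (n, v)" e]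
    le_prod_encode_2[of v n]
  unfolding fact_code_def by linarith

text \<open>The facts of a set need no order: a justification only refers to facts with a smaller
  program code or, for \<^const>\<open>CPrec\<close>, with the same code and a smaller recursion argument.
  \<open>Q\<close> is the available part of the graph of the oracle.\<close>

definition justified :: "(nat \<Rightarrow> nat \<Rightarrow> bool) \<Rightarrow> nat set \<Rightarrow> nat \<Rightarrow> nat \<Rightarrow> nat \<Rightarrow> bool" where
  "justified Q D e n v \<longleftrightarrow>
     e = 0 \<and> v = 0 \<or> e = 1 \<and> v = Suc n \<or> e = 2 \<and> v = fst (prod_decode n) \<or>
     e = 3 \<and> v = snd (prod_decode n) \<or> e = 4 \<and> Q n v \<or>
     (\<exists>q\<le>e. let l = fst (prod_decode q); r = snd (prod_decode q) in
        e = 4 * q + 5 \<and> fact_code l n (fst (prod_decode v)) \<in> D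
                     \<and> fact_code r n (snd (prod_decode v)) \<in> D \<or>
        e = 4 * q + 6 \<and> (\<exists>y. fact_code r n y \<in> D \<and> fact_code l y v \<in> D) \<or>
        e = 4 * q + 7 \<and> snd (prod_decode n) = 0 \<and> fact_code l (fst (prod_decode n)) v \<in> D \<or>
        e = 4 * q + 7 \<and> snd (prod_decode n) \<noteq> 0 \<and>
          (\<exists>y. fact_code e (prod_encode (fst (prod_decode n), snd (prod_decode n) - 1)) y \<in> D \<and>
               fact_code r (prod_encode (fst (prod_decode n),
                 prod_encode (snd (prod_decode n) - 1, y))) v \<in> D) \<or>
        e = 4 * q + 8 \<and> fact_code q (prod_encode (n, v)) 0 \<in> D \<and>
          (\<forall>i<v. \<exists>y. fact_code q (prod_encode (n, i)) (Suc y) \<in> D))"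

definition derivation :: "(nat \<Rightarrow> nat \<Rightarrow> bool) \<Rightarrow> nat set \<Rightarrow> bool" where
  "derivation Q D \<longleftrightarrow> (\<forall>e n v. fact_code e n v \<in> D \<longrightarrow> justified Q D e n v)"

text \<open>The offsets 5 to 8 differ modulo 4, so the code determines both its constructor and
  \<open>q\<close>, and only one clause of \<open>justified\<close> can apply.\<close>

lemma justified_compound:
  fixes q defines "l \<equiv> fst (prod_decode q)" and "r \<equiv> snd (prod_decode q)"
  shows justified_CPair: "justified Q D (4 * q + 5) n v \<longleftrightarrow>
      fact_code l n (fst (prod_decode v)) \<in> D \<and> fact_code r n (snd (prod_decode v)) \<in> D"
    and justified_CComp: "justified Q D (4 * q + 6) n v \<longleftrightarrow>
      (\<exists>y. fact_code r n y \<in> D \<and> fact_code l y v \<in> D)"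
    and justified_CPrec_0: "justified Q D (4 * q + 7) (prod_encode (a, 0)) v \<longleftrightarrow>
      fact_code l a v \<in> D"
    and justified_CPrec_Suc: "justified Q D (4 * q + 7) (prod_encode (a, Suc m)) v \<longleftrightarrow>
      (\<exists>y. fact_code (4 * q + 7) (prod_encode (a, m)) y \<in> D \<and>
           fact_code r (prod_encode (a, prod_encode (m, y))) v \<in> D)"
    and justified_CMu: "justified Q D (4 * q + 8) n v \<longleftrightarrow>
      fact_code q (prod_encode (n, v)) 0 \<in> D \<and>
      (\<forall>i<v. \<exists>y. fact_code q (prod_encode (n, i)) (Suc y) \<in> D)"
proof -
  have [simp]: "4 * q + 5 \<noteq> 4 * q' + 6" "4 * q + 5 \<noteq> 4 * q' + 7" "4 * q + 5 \<noteq> 4 * q' + 8"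
    "4 * q + 6 \<noteq> 4 * q' + 5" "4 * q + 6 \<noteq> 4 * q' + 7" "4 * q + 6 \<noteq> 4 * q' + 8"
    "4 * q + 7 \<noteq> 4 * q' + 5" "4 * q + 7 \<noteq> 4 * q' + 6" "4 * q + 7 \<noteq> 4 * q' + 8"
    "4 * q + 8 \<noteq> 4 * q' + 5" "4 * q + 8 \<noteq> 4 * q' + 6" "4 * q + 8 \<noteq> 4 * q' + 7" for q' :: nat
    by presburger+
  have [simp]: "4 * q + 5 = 4 * q' + 5 \<longleftrightarrow> q' = q" "4 * q + 6 = 4 * q' + 6 \<longleftrightarrow> q' = q"
    "4 * q + 7 = 4 * q' + 7 \<longleftrightarrow> q' = q" "4 * q + 8 = 4 * q' + 8 \<longleftrightarrow> q' = q" for q'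
    by auto
  have [simp]: "4 * q + 5 \<noteq> 0" "4 * q + 5 \<noteq> 1" "4 * q + 5 \<noteq> 2" "4 * q + 5 \<noteq> 3" "4 * q + 5 \<noteq> 4"
    "4 * q + 6 \<noteq> 0" "4 * q + 6 \<noteq> 1" "4 * q + 6 \<noteq> 2" "4 * q + 6 \<noteq> 3" "4 * q + 6 \<noteq> 4"
    "4 * q + 7 \<noteq> 0" "4 * q + 7 \<noteq> 1" "4 * q + 7 \<noteq> 2" "4 * q + 7 \<noteq> 3" "4 * q + 7 \<noteq> 4"
    "4 * q + 8 \<noteq> 0" "4 * q + 8 \<noteq> 1" "4 * q + 8 \<noteq> 2" "4 * q + 8 \<noteq> 3" "4 * q + 8 \<noteq> 4"
    by arith+
  have [simp]: "q \<le> 4 * q + 5" "q \<le> 4 * q + 6" "q \<le> 4 * q + 7" "q \<le> 4 * q + 8"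
    by arith+
  show "justified Q D (4 * q + 5) n v \<longleftrightarrow>
      fact_code l n (fst (prod_decode v)) \<in> D \<and> fact_code r n (snd (prod_decode v)) \<in> D"
    "justified Q D (4 * q + 6) n v \<longleftrightarrow> (\<exists>y. fact_code r n y \<in> D \<and> fact_code l y v \<in> D)"
    "justified Q D (4 * q + 7) (prod_encode (a, 0)) v \<longleftrightarrow> fact_code l a v \<in> D"
    "justified Q D (4 * q + 7) (prod_encode (a, Suc m)) v \<longleftrightarrow>
      (\<exists>y. fact_code (4 * q + 7) (prod_encode (a, m)) y \<in> D \<and>
           fact_code r (prod_encode (a, prod_encode (m, y))) v \<in> D)"
    "justified Q D (4 * q + 8) n v \<longleftrightarrow>
      fact_code q (prod_encode (n, v)) 0 \<in> D \<and>
      (\<forall>i<v. \<exists>y. fact_code q (prod_encode (n, i)) (Suc y) \<in> D)"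
    unfolding justified_def Let_def l_def r_def
    by (simp_all del: add_eq_0_iff_both_eq_0 One_nat_def)
qed

section \<open>Soundness of derivations\<close>

lemma derivation_sound:
  assumes D: "derivation Q D" and Q: "\<And>n v. Q n v \<Longrightarrow> v = p n"
    and "fact_code e n v \<in> D"
  shows "eval p (prog_of e) n = Some v"
  using assms(3)
proof (induction e arbitrary: n v rule: less_induct)
  case (less e)
  have J: "justified Q D e n v" if "fact_code e n v \<in> D" for n v
    using D that by (auto simp: derivation_def)
  show ?case
  proof (cases "e < 5")
    case True
    then have "e \<in> {0, 1, 2, 3, 4}" by auto
    moreover have "\<not> (\<exists>q\<le>e. e = 4 * q + 5 \<or> e = 4 * q + 6 \<or> e = 4 * q + 7 \<or> e = 4 * q + 8)"
      using True by auto
    ultimately show ?thesis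
      using J[OF less.prems] Q unfolding justified_def Let_def
      by (auto simp: prog_of.simps[of e])
  next
    case False
    then have "\<exists>q. e = 4 * q + 5 \<or> e = 4 * q + 6 \<or> e = 4 * q + 7 \<or> e = 4 * q + 8"
      by presburger
    then obtain q where q: "e = 4 * q + 5 \<or> e = 4 * q + 6 \<or> e = 4 * q + 7 \<or> e = 4 * q + 8" ..
    define l r where lr: "l = fst (prod_decode q)" "r = snd (prod_decode q)"
    have "q < e" "l < e" "r < e"
      using q prod_decode_le[of q] by (auto simp: lr)
    note IH = less.IH[OF this(1)] less.IH[OF this(2)] less.IH[OF this(3)]
    note compound = justified_compound[of _ _ q, folded lr] prog_of_compound[of q, folded lr]
    from q consider "e = 4 * q + 5" | "e = 4 * q + 6" | "e = 4 * q + 7" | "e = 4 * q + 8" by blast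
    then show ?thesis
    proof cases
      case 1
      then show ?thesis
        using J[OF less.prems] IH(2,3) by (simp only: compound) (auto simp: IH)
    next
      case 2
      then show ?thesis
        using J[OF less.prems] IH(2,3) by (simp only: compound) (auto simp: IH)
    next
      case 3
      \<comment> \<open>A \<open>CPrec\<close> fact may cite a fact with the same code
        \<open>e\<close>, which the outer induction does not cover; the recursion argument decreases
        instead.\<close>
      have "rec_nat (eval p (prog_of l) a) (\<lambda>i x. Option.bind x (\<lambda>y.
              eval p (prog_of r) (prod_encode (a, prod_encode (i, y))))) m = Some v"
        if "fact_code e (prod_encode (a, m)) v \<in> D" for a m v
        using that
      proof (induction m arbitrary: v)
        case 0
        then show ?case using J[OF 0] IH(2) by (simp add: 3 compound(3))
      next
        case (Suc m)
        then obtain y where "fact_code e (prod_encode (a, m)) y \<in> D"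
          "fact_code r (prod_encode (a, prod_encode (m, y))) v \<in> D"
          using J[OF Suc.prems] unfolding 3 compound(4) by blast
        then show ?case using Suc.IH IH(3) by simp
      qed
      from this[of "fst (prod_decode n)" "snd (prod_decode n)" v] less.prems show ?thesis
        unfolding 3 compound by (simp add: case_prod_beta)
    next
      case 4
      have J': "fact_code q (prod_encode (n, v)) 0 \<in> D"
        "\<And>i. i < v \<Longrightarrow> \<exists>y. fact_code q (prod_encode (n, i)) (Suc y) \<in> D"
        using J[OF less.prems] unfolding 4 compound by auto
      have v: "eval p (prog_of q) (prod_encode (n, v)) = Some 0"
        "\<And>i. i < v \<Longrightarrow> \<exists>y. eval p (prog_of q) (prod_encode (n, i)) = Some (Suc y)"
        using J' IH(1) by blast+
      \<comment> \<open>Below \<open>v\<close> all values are successors, so no earlier zero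
        exists.\<close>
      have "(LEAST k. eval p (prog_of q) (prod_encode (n, k)) = Some 0 \<and>
                (\<forall>i<k. eval p (prog_of q) (prod_encode (n, i)) \<noteq> None)) = v"
        using v by (intro Least_equality) (fastforce simp: not_less[symmetric])+
      moreover have "\<exists>k. eval p (prog_of q) (prod_encode (n, k)) = Some 0 \<and>
                (\<forall>i<k. eval p (prog_of q) (prod_encode (n, i)) \<noteq> None)"
        using v by fastforce
      ultimately show ?thesis unfolding 4 compound by (simp add: Let_def)
    qed
  qed
qed


section \<open>Monotonicity and completeness of derivations\<close>

text \<open>Both \<open>D\<close> and \<open>Q\<close> occur only positively in
  \<open>justified\<close>.\<close>

lemma justified_mono:
  assumes "justified Q D e n v" "D \<subseteq> D'" "\<And>i w. Q i w \<Longrightarrow> Q' i w"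
  shows "justified Q' D' e n v"
proof -
  have "justified Q D e n v \<longrightarrow> justified Q' D' e n v"
    unfolding justified_def Let_def using assms(2,3)
    by (intro disj_mono conj_mono ex_mono all_mono imp_mono imp_refl in_mono) auto
  with assms(1) show ?thesis by blast
qed

lemma derivation_mono: "derivation Q' D" if "derivation Q D" "\<And>i w. Q i w \<Longrightarrow> Q' i w"
  using that justified_mono[of Q D _ _ _ D Q'] unfolding derivation_def by blast

lemma derivation_Un: "derivation Q (D \<union> D')" if "derivation Q D" "derivation Q D'"
  using that justified_mono[of Q D _ _ _ "D \<union> D'" Q] justified_mono[of Q D' _ _ _ "D \<union> D'" Q]
  unfolding derivation_def by blast

lemma derivation_insert:
  "derivation Q (insert (fact_code e n v) D)" if "derivation Q D" "justified Q D e n v"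
proof -
  have "justified Q (insert (fact_code e n v) D) i j k" if "justified Q D i j k" for i j k
    using that by (rule justified_mono) auto
  with that show ?thesis unfolding derivation_def by (auto simp: fact_code_def)
qed

text \<open>A derivation is finite, so it consults only finitely many oracle values.\<close>

definition derivable :: "(nat \<Rightarrow> nat) \<Rightarrow> nat \<Rightarrow> bool" where
  "derivable p x \<longleftrightarrow> (\<exists>N D. finite D \<and> derivation (\<lambda>i w. i < N \<and> w = p i) D \<and> x \<in> D)"

text \<open>Derivations are merged by union, and their oracle bounds by maximum. The lower bound
  \<open>M\<close> leaves room for an oracle position needed by the next inference.\<close>

lemma derivable_common:
  assumes "finite S" "\<And>x. x \<in> S \<Longrightarrow> derivable p x"
  shows "\<exists>N\<ge>M. \<exists>D. finite D \<and> derivation (\<lambda>i w. i < N \<and> w = p i) D \<and> S \<subseteq> D"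
  using assms
proof (induction S)
  case empty
  show ?case by (intro exI[of _ M] exI[of _ "{}"] conjI) (simp_all add: derivation_def)
next
  case (insert x S)
  then obtain N D where 1: "N \<ge> M" "finite D" "derivation (\<lambda>i w. i < N \<and> w = p i) D" "S \<subseteq> D"
    by auto
  from insert.prems have "derivable p x" by simp
  then obtain N' D' where
    2: "finite D'" "derivation (\<lambda>i w. i < N' \<and> w = p i) D'" "x \<in> D'"
    unfolding derivable_def by auto
  have "derivation (\<lambda>i w. i < max N N' \<and> w = p i) (D \<union> D')"
    by (rule derivation_Un; rule derivation_mono[OF 1(3)] derivation_mono[OF 2(2)]) auto
  then show ?case
    using 1 2 by (intro exI[of _ "max N N'"] conjI exI[of _ "D \<union> D'"]) auto
qed

text \<open>Turns \<open>justified\<close> into an inference rule with finitely many premises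
  \<open>S\<close>, so that completeness needs one application per program constructor.\<close>

lemma derivable_step:
  assumes "finite S" "\<And>x. x \<in> S \<Longrightarrow> derivable p x"
    and "justified (\<lambda>i w. i < M \<and> w = p i) S e n v"
  shows "derivable p (fact_code e n v)"
proof -
  from derivable_common[OF assms(1,2)] obtain N D where
    ND: "M \<le> N" "finite D" "derivation (\<lambda>i w. i < N \<and> w = p i) D" "S \<subseteq> D" by blast
  have "justified (\<lambda>i w. i < N \<and> w = p i) D e n v"
    using justified_mono[OF assms(3) ND(4)] ND(1) by auto
  then show ?thesis
    using derivation_insert[OF ND(3)] ND(2) unfolding derivable_def
    by (intro exI[of _ N] exI[of _ "insert (fact_code e n v) D"]) auto
qed

lemma derivation_complete:
  "eval p c n = Some v \<Longrightarrow> derivable p (fact_code (code_of c) n v)"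
proof (induction c arbitrary: n v)
  case (CPair c d)
  then obtain a b where "eval p c n = Some a" "eval p d n = Some b" "v = prod_encode (a, b)"
    by (auto simp: bind_eq_Some_conv)
  with CPair.IH show ?case
    unfolding code_of.simps
    by (intro derivable_step[of "{fact_code (code_of c) n a, fact_code (code_of d) n b}"])
       (auto simp only: justified_CPair, auto)
next
  case (CComp c d)
  then obtain a where "eval p d n = Some a" "eval p c a = Some v"
    by (auto simp: bind_eq_Some_conv)
  with CComp.IH show ?case
    unfolding code_of.simps
    by (intro derivable_step[of "{fact_code (code_of d) n a, fact_code (code_of c) a v}"])
       (auto simp only: justified_CComp, auto)
next
  case (CPrec c d)
  define q where "q = prod_encode (code_of c, code_of d)"
  have "derivable p (fact_code (4 * q + 7) (prod_encode (a, m)) v)"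
    if "rec_nat (eval p c a) (\<lambda>i x. Option.bind x (\<lambda>y.
          eval p d (prod_encode (a, prod_encode (i, y))))) m = Some v" for a m v
    using that
  proof (induction m arbitrary: v)
    case 0
    then show ?case
      using CPrec.IH(1) by (intro derivable_step[of "{fact_code (code_of c) a v}"])
        (auto simp only: justified_CPrec_0, auto simp: q_def)
  next
    case (Suc m)
    from Suc.prems obtain y where "rec_nat (eval p c a) (\<lambda>i x. Option.bind x (\<lambda>y.
          eval p d (prod_encode (a, prod_encode (i, y))))) m = Some y"
      "eval p d (prod_encode (a, prod_encode (m, y))) = Some v"
      by (auto simp: bind_eq_Some_conv)
    then show ?case
      using CPrec.IH(2) Suc.IH
      by (intro derivable_step[of "{fact_code (4 * q + 7) (prod_encode (a, m)) y,
            fact_code (code_of d) (prod_encode (a, prod_encode (m, y))) v}"])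
        (auto simp only: justified_CPrec_Suc, auto simp: q_def)
  qed
  from this[of "fst (prod_decode n)" "snd (prod_decode n)" v] CPrec.prems
  show ?case by (simp add: q_def case_prod_beta)
next
  case (CMu c)
  define P where "P = (\<lambda>k. eval p c (prod_encode (n, k)) = Some 0 \<and>
    (\<forall>i<k. eval p c (prod_encode (n, i)) \<noteq> None))"
  from CMu.prems have v: "\<exists>k. P k" "v = (LEAST k. P k)"
    unfolding P_def by (auto simp: Let_def split: if_splits)
  then have "P v" by (auto intro: LeastI_ex)
  have pos: "\<exists>y. eval p c (prod_encode (n, i)) = Some (Suc y)" if "i < v" for i
  proof -
    from that have "\<not> P i" unfolding v(2) by (rule not_less_Least)
    moreover from \<open>P v\<close> that obtain y where "eval p c (prod_encode (n, i)) = Some y"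
      unfolding P_def by auto
    ultimately show ?thesis using \<open>P v\<close> that unfolding P_def by (cases y) auto
  qed
  \<comment> \<open>The nonzero values below \<open>v\<close> are the remaining premises of the
    \<open>CMu\<close> clause.\<close>
  then obtain y where y: "\<And>i. i < v \<Longrightarrow> eval p c (prod_encode (n, i)) = Some (Suc (y i))" by metis
  show ?case
    unfolding code_of.simps
  proof (rule derivable_step)
    let ?S = "insert (fact_code (code_of c) (prod_encode (n, v)) 0)
      ((\<lambda>i. fact_code (code_of c) (prod_encode (n, i)) (Suc (y i))) ` {..<v})"
    show "finite ?S" by simp
    show "derivable p x" if "x \<in> ?S" for x
      using that y \<open>P v\<close> CMu.IH unfolding P_def by auto
    show "justified (\<lambda>i w. i < 0 \<and> w = p i) ?S (4 * code_of c + 8) n v"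
      unfolding justified_CMu by auto
  qed
next
  case COracle
  \<comment> \<open>The only inference that reads the oracle: the bound \<open>Suc n\<close> makes
    position \<open>n\<close> available.\<close>
  then show ?case
    by (intro derivable_step[of "{}" p "Suc n"]) (auto simp: justified_def)
qed (intro derivable_step[of "{}" _ 0], auto simp: justified_def)+

section \<open>Decidability of derivations\<close>

lemma derivation_set_decode_iff:
  "derivation Q (set_decode D) \<longleftrightarrow> (\<forall>x\<le>D. x \<in> set_decode D \<longrightarrow>
     justified Q (set_decode D) (fst (prod_decode x)) (fst (prod_decode (snd (prod_decode x))))
       (snd (prod_decode (snd (prod_decode x)))))" (is "?L \<longleftrightarrow> ?R")
proof
  assume ?L
  then show ?R unfolding derivation_def fact_code_def
    by (metis prod.collapse prod_decode_inverse)
next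
  assume R: ?R
  show ?L unfolding derivation_def
  proof (intro allI impI)
    fix e n v assume x: "fact_code e n v \<in> set_decode D"
    with R[rule_format, OF less_imp_le[OF mem_set_decode_less[OF x]] x]
    show "justified Q (set_decode D) e n v" by (simp add: fact_code_def)
  qed
qed

text \<open>Rewrites the unbounded quantifiers of \<open>justified\<close> into forms that the
  closure rules for decidability accept.\<close>

lemma bounded_witness:
  "(\<exists>y. fact_code e n y \<in> set_decode D \<and> P y) \<longleftrightarrow>
     (\<exists>y\<le>D. fact_code e n y \<in> set_decode D \<and> P y)"
  "(\<exists>y. fact_code e n (Suc y) \<in> set_decode D) \<longleftrightarrow> (\<exists>y\<le>D. fact_code e n (Suc y) \<in> set_decode D)"
  using fact_code_bound Suc_leD by blast+

lemma decidable_derivation [recursive_intros]: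
  assumes "recursive f" "recursive g" "recursive h"
  shows "decidable (\<lambda>p n. derivation (\<lambda>i w. fact_code (f p n) i w \<in> set_decode (g p n))
           (set_decode (h p n)))"
proof -
  \<comment> \<open>The three parameters are first taken as projections; substituting
    \<open>f\<close>, \<open>g\<close> and \<open>h\<close> afterwards keeps them out of the nested
    quantifiers.\<close>
  have "decidable (\<lambda>p n. derivation (\<lambda>i w. fact_code (fst (prod_decode n)) i w
      \<in> set_decode (fst (prod_decode (snd (prod_decode n)))))
      (set_decode (snd (prod_decode (snd (prod_decode n))))))"
    unfolding derivation_set_decode_iff justified_def Let_def bounded_witness
    by (intro recursive_intros)
  from decidable_compose[OF this, of "\<lambda>p n. prod_encode (f p n, prod_encode (g p n, h p n))"]
  show ?thesis by (simp add: assms recursive_pair)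
qed


text \<open>The oracle facts of a valid set are those it contains about program 0, the zero function.\<close>

definition valid :: "nat \<Rightarrow> bool" where
  "valid D \<longleftrightarrow> derivation (\<lambda>i w. fact_code 0 i w \<in> set_decode D) (set_decode D)"

definition proves :: "nat \<Rightarrow> nat \<Rightarrow> nat \<Rightarrow> nat \<Rightarrow> bool" where
  "proves D e n v \<longleftrightarrow> valid D \<and> fact_code e n v \<in> set_decode D"

lemma decidable_valid [recursive_intros]: "decidable (\<lambda>p n. valid (f p n))" if "recursive f"
  unfolding valid_def by (intro recursive_intros that)

lemma decidable_proves [recursive_intros]:
  "decidable (\<lambda>p n. proves (f p n) (g p n) (h p n) (k p n))"
  if "recursive f" "recursive g" "recursive h" "recursive k"
  unfolding proves_def by (intro recursive_intros that)

lemma proves_sound: "phi e n = Some v" if "proves D e n v"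
proof -
  have D: "derivation (\<lambda>i w. fact_code 0 i w \<in> set_decode D) (set_decode D)"
    using that by (simp add: proves_def valid_def)
  \<comment> \<open>Code 0 is \<open>CZero\<close>, so its facts can only carry the value 0 and
    agree with the trivial oracle.\<close>
  have "w = 0" if "fact_code 0 i w \<in> set_decode D" for i w
    using D that unfolding derivation_def justified_def by fastforce
  with derivation_sound[OF D, of "\<lambda>_. 0" e n v] that show ?thesis
    by (simp add: phi_def Phi_def proves_def)
qed

lemma valid_superset:
  assumes "finite S" "\<And>e n v. fact_code e n v \<in> S \<Longrightarrow> phi e n = Some v"
  shows "\<exists>D. valid D \<and> S \<subseteq> set_decode D"
proof -
  have "derivable (\<lambda>_. 0) x" if "x \<in> S" for x
  proof -
    obtain e n v where x: "x = fact_code e n v"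
      unfolding fact_code_def by (metis prod.collapse prod_decode_inverse)
    then have "eval (\<lambda>_. 0) (prog_of e) n = Some v"
      using assms(2) that by (simp add: phi_def Phi_def)
    from derivation_complete[OF this] show ?thesis by (simp add: x code_of_prog_of)
  qed
  from derivable_common[OF assms(1) this] obtain N D where
    D: "finite D" "derivation (\<lambda>i w. i < N \<and> w = 0) D" "S \<subseteq> D" by blast
  \<comment> \<open>The derivation \<open>D\<close> may consult the zero oracle below
    \<open>N\<close>; adding these values as facts about program 0 makes the set self-contained, as
    \<open>valid\<close> demands.\<close>
  define Z where "Z = (\<lambda>i. fact_code 0 i 0) ` {..<N}"
  have "derivation (\<lambda>i w. i < N \<and> w = 0) Z"
    unfolding derivation_def justified_def Z_def by (auto simp: fact_code_def)
  then have "derivation (\<lambda>i w. fact_code 0 i w \<in> D \<union> Z) (D \<union> Z)"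
    by (rule derivation_mono[OF derivation_Un[OF D(2)]]) (auto simp: Z_def)
  moreover have "finite (D \<union> Z)" using D(1) by (simp add: Z_def)
  ultimately show ?thesis
    using D(3) unfolding valid_def
    by (intro exI[of _ "set_encode (D \<union> Z)"]) (simp add: set_encode_inverse, blast)
qed

lemma proves_iff: "phi e n = Some v \<longleftrightarrow> (\<exists>D. proves D e n v)"
proof
  assume "phi e n = Some v"
  then have "\<exists>D. valid D \<and> {fact_code e n v} \<subseteq> set_decode D"
    by (intro valid_superset) (auto simp: fact_code_def)
  then show "\<exists>D. proves D e n v" by (auto simp: proves_def)
qed (auto dest: proves_sound)

text \<open>A two-level certificate: \<open>E\<close> certifies the finitely many oracle values
  through program \<open>e\<close>, and \<open>D\<close> is a derivation relative to them. The
  right-hand side thus depends on \<open>e\<close> alone and no longer on \<open>p\<close>.\<close>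

lemma Phi_iff_derivation:
  assumes p: "\<And>n. phi e n = Some (p n)"
  shows "Phi p m k = Some v \<longleftrightarrow> (\<exists>E D. valid E \<and>
    derivation (\<lambda>i w. fact_code e i w \<in> set_decode E) (set_decode D) \<and>
    fact_code m k v \<in> set_decode D)" (is "_ \<longleftrightarrow> ?R")
proof
  assume "Phi p m k = Some v"
  from derivation_complete[OF this[unfolded Phi_def]] obtain N D where
    D: "finite D" "derivation (\<lambda>i w. i < N \<and> w = p i) D" "fact_code m k v \<in> D"
    unfolding derivable_def code_of_prog_of by blast
  have "\<exists>E. valid E \<and> (\<lambda>i. fact_code e i (p i)) ` {..<N} \<subseteq> set_decode E"
    by (intro valid_superset) (auto simp: fact_code_def p)
  then obtain E where E: "valid E" "(\<lambda>i. fact_code e i (p i)) ` {..<N} \<subseteq> set_decode E" by blast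
  have "derivation (\<lambda>i w. fact_code e i w \<in> set_decode E) D"
    by (rule derivation_mono[OF D(2)]) (use E(2) in auto)
  then show ?R
    using D E(1) by (intro exI[of _ E] exI[of _ "set_encode D"]) (simp add: set_encode_inverse)
next
  assume ?R
  then obtain E D where E: "valid E"
    and D: "derivation (\<lambda>i w. fact_code e i w \<in> set_decode E) (set_decode D)"
      "fact_code m k v \<in> set_decode D" by blast
  have "w = p i" if "fact_code e i w \<in> set_decode E" for i w
    using proves_sound[of E e i w] that E p by (simp add: proves_def)
  from derivation_sound[OF D(1) this D(2)] show "Phi p m k = Some v" by (simp add: Phi_def)
qed

lemma unbounded_search:
  assumes "decidable P"
  shows "\<exists>c. \<forall>p n. eval p c n =
    (if \<exists>w. P p (prod_encode (n, w)) then Some (LEAST w. P p (prod_encode (n, w))) else None)"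
proof -
  from assms obtain c where "\<forall>p n. eval p c n = Some (if P p n then 0 else 1)"
    unfolding decidable_def recursive_def by blast
  then show ?thesis by (intro exI[of _ "CMu c"]) simp
qed

text \<open>Search for a coded pair of a certificate and a value, then project to the value. By
  soundness any pair found gives the correct result.\<close>

lemma universal_program: "\<exists>u. \<forall>p e n. eval p u (prod_encode (e, n)) = phi e n"
proof -
  define P where "P = (\<lambda>(p :: nat \<Rightarrow> nat) x. proves (fst (prod_decode (snd (prod_decode x))))
    (fst (prod_decode (fst (prod_decode x)))) (snd (prod_decode (fst (prod_decode x))))
    (snd (prod_decode (snd (prod_decode x)))))"
  have "decidable P" unfolding P_def by (intro recursive_intros)
  from unbounded_search[OF this] obtain c where c: "\<And>p n. eval p c n =
    (if \<exists>w. P p (prod_encode (n, w)) then Some (LEAST w. P p (prod_encode (n, w))) else None)"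
    by blast
  have "eval p (CComp CSnd c) (prod_encode (e, n)) = phi e n" for p e n
  proof (cases "\<exists>w. P p (prod_encode (prod_encode (e, n), w))")
    case True
    then have "P p (prod_encode (prod_encode (e, n),
      LEAST w. P p (prod_encode (prod_encode (e, n), w))))" by (rule LeastI_ex)
    then have "phi e n = Some (snd (prod_decode
      (LEAST w. P p (prod_encode (prod_encode (e, n), w)))))"
      unfolding P_def by (auto dest: proves_sound)
    then show ?thesis using True c by simp
  next
    case False
    have "phi e n \<noteq> Some v" for v
    proof
      assume "phi e n = Some v"
      then obtain D where "proves D e n v" by (auto simp: proves_iff)
      then have "P p (prod_encode (prod_encode (e, n), prod_encode (D, v)))" by (simp add: P_def)
      with False show False by blast
    qed
    then have "phi e n = None" by (cases "phi e n") auto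
    then show ?thesis using False c by simp
  qed
  then show ?thesis by blast
qed

section \<open>The recursion theorem\<close>

text \<open>The code of \<open>CSucc\<close> composed \<open>z\<close> times with
  \<open>CZero\<close>: 1 codes \<open>CSucc\<close>, and the offset 6 codes
  \<open>CComp\<close>.\<close>

definition const_code :: "nat \<Rightarrow> nat" where
  "const_code z = rec_nat 0 (\<lambda>_ y. 4 * prod_encode (1, y) + 6) z"

text \<open>The code of program \<open>r\<close> composed with the pairing of the constant
  \<open>z\<close> and the identity, as in the s-m-n theorem.\<close>

definition smn :: "nat \<Rightarrow> nat \<Rightarrow> nat" where
  "smn r z = 4 * prod_encode (r, 4 * prod_encode (const_code z, code_of (CPair CFst CSnd)) + 5) + 6"

lemma recursive_smn [recursive_intros]:
  assumes "recursive f" "recursive g"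
  shows "recursive (\<lambda>p n. smn (f p n) (g p n))"
  unfolding smn_def const_code_def by (intro recursive_intros recursive_rec_nat assms)

lemma Phi_smn: "Phi p (smn r z) n = Phi p r (prod_encode (z, n))"
proof -
  have "eval p (prog_of (const_code z)) n = Some z"
  proof (induction z)
    case 0
    then show ?case by (simp add: const_code_def prog_of.simps)
  next
    case (Suc z)
    have "prog_of (const_code (Suc z)) = CComp CSucc (prog_of (const_code z))"
      by (simp add: const_code_def prog_of_compound del: One_nat_def) (simp add: prog_of.simps)
    then show ?case using Suc by simp
  qed
  then show ?thesis
    unfolding smn_def Phi_def by (simp only: prog_of_compound prod_encode_inverse fst_conv
        snd_conv prog_of_code_of) simp
qed

lemma phi_smn: "phi (smn r z) n = phi r (prod_encode (z, n))"
  by (simp add: phi_def Phi_smn)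

text \<open>Kleene's recursion theorem with parameters: the computation of program \<open>r z\<close> on \<open>n\<close> may
  be redirected to any program and input computed from \<open>r z\<close>, \<open>z\<close> and \<open>n\<close>.\<close>

lemma recursion_theorem:
  assumes "recursive (\<lambda>p x. H x)"
  shows "\<exists>r. recursive (\<lambda>p z. r z) \<and> (\<forall>z n. phi (r z) n =
    (case prod_decode (H (prod_encode (r z, prod_encode (z, n)))) of (e, l) \<Rightarrow> phi e l))"
proof -
  obtain u where u: "\<And>p e n. eval p u (prod_encode (e, n)) = phi e n"
    using universal_program by blast
  have "recursive (\<lambda>p x. H (prod_encode (smn (fst (prod_decode (fst (prod_decode x))))
      (fst (prod_decode x)), prod_encode (snd (prod_decode (fst (prod_decode x))),
      snd (prod_decode x)))))"
    by (intro recursive_compose[OF assms] recursive_intros)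
  then obtain h where h: "\<And>p x. eval p h x = Some (H (prod_encode
      (smn (fst (prod_decode (fst (prod_decode x)))) (fst (prod_decode x)),
       prod_encode (snd (prod_decode (fst (prod_decode x))), snd (prod_decode x)))))"
    unfolding recursive_def by blast
  \<comment> \<open>Self-application: given the parameter pair of a code and \<open>z\<close>,
    \<open>h\<close> rebuilds the specialisation of that code to the pair. For the code
    \<open>d\<close> itself this is \<open>r z\<close>.\<close>
  define d where "d = code_of (CComp u h)"
  define r where "r = (\<lambda>z. smn d (prod_encode (d, z)))"
  have "phi (r z) n =
    (case prod_decode (H (prod_encode (r z, prod_encode (z, n)))) of (e, l) \<Rightarrow> phi e l)" for z n
  proof -
    have "phi (r z) n = eval (\<lambda>_. 0) u (H (prod_encode (r z, prod_encode (z, n))))"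
      unfolding r_def phi_smn by (simp add: phi_def Phi_def d_def prog_of_code_of h del: code_of.simps)
    also have "\<dots> = (case prod_decode (H (prod_encode (r z, prod_encode (z, n)))) of (e, l) \<Rightarrow> phi e l)"
      by (metis u case_prod_beta prod.collapse prod_decode_inverse)
    finally show ?thesis .
  qed
  moreover have "recursive (\<lambda>p z. r z)" unfolding r_def by (intro recursive_intros)
  ultimately show ?thesis by blast
qed

lemma total_computableI: "total_computable f" if "recursive (\<lambda>p n. f n)"
proof -
  from that obtain c where "\<And>p n. eval p c n = Some (f n)" unfolding recursive_def by blast
  then show ?thesis
    unfolding total_computable_def phi_def Phi_def
    by (intro exI[of _ "code_of c"]) (simp add: prog_of_code_of)
qed

text \<open>One search program handles all \<open>m\<close>; specialising it by \<open>smn\<close>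
  makes the index computable from \<open>m\<close>.\<close>

lemma uniform_semidecision:
  assumes "decidable P"
  shows "\<exists>f. total_computable f \<and>
    (\<forall>p m n. Phi p (f m) n \<noteq> None \<longleftrightarrow> (\<exists>w. P p (prod_encode (prod_encode (m, n), w))))"
proof -
  from unbounded_search[OF assms] obtain c where c: "\<And>p n. eval p c n =
    (if \<exists>w. P p (prod_encode (n, w)) then Some (LEAST w. P p (prod_encode (n, w))) else None)"
    by blast
  have "total_computable (smn (code_of c))"
    by (rule total_computableI) (intro recursive_intros)
  moreover have "Phi p (smn (code_of c) m) n \<noteq> None \<longleftrightarrow>
      (\<exists>w. P p (prod_encode (prod_encode (m, n), w)))" for p m n
    unfolding Phi_smn by (simp add: Phi_def prog_of_code_of c)
  ultimately show ?thesis by blast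
qed


section \<open>Markov names and K-names\<close>

text \<open>Here \<open>t\<close> bounds the certificate and the output instead of counting steps,
  which gives a decidable relation, monotone in \<open>t\<close>.\<close>

definition halted :: "nat \<Rightarrow> nat \<Rightarrow> nat \<Rightarrow> bool" where
  "halted m e t \<longleftrightarrow> (\<exists>D\<le>t. \<exists>v\<le>t. proves D m e v)"

lemma decidable_halted [recursive_intros]:
  assumes "recursive f" "recursive g" "recursive h"
  shows "decidable (\<lambda>p n. halted (f p n) (g p n) (h p n))"
  unfolding halted_def by (intro recursive_intros assms recursive_compose[OF assms(1)]
      recursive_compose[OF assms(2)] recursive_compose[OF assms(3)])

lemma halted_iff: "phi m e \<noteq> None \<longleftrightarrow> (\<exists>t. halted m e t)"
proof
  assume "phi m e \<noteq> None"
  then obtain v D where "proves D m e v" by (auto simp: proves_iff)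
  then have "halted m e (max D v)" unfolding halted_def by (meson max.cobounded1 max.cobounded2)
  then show "\<exists>t. halted m e t" ..
qed (auto simp: halted_def dest: proves_sound)

lemma halted_mono: "halted m e t \<Longrightarrow> t \<le> t' \<Longrightarrow> halted m e t'"
  unfolding halted_def by (meson le_trans)

lemma uniform_bound_le:
  fixes P :: "nat \<Rightarrow> nat \<Rightarrow> bool"
  assumes "\<And>i. i \<le> k \<Longrightarrow> \<exists>t. P i t" and "\<And>i t t'. P i t \<Longrightarrow> t \<le> t' \<Longrightarrow> P i t'"
  shows "\<exists>t. \<forall>i\<le>k. P i t"
proof -
  from assms(1) obtain f where f: "\<And>i. i \<le> k \<Longrightarrow> P i (f i)" by metis
  have "f i \<le> Max (f ` {..k})" if "i \<le> k" for i using that by simp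
  with f assms(2) show ?thesis by blast
qed

text \<open>Program \<open>r (m, i, a, c)\<close> copies program \<open>i\<close> until machine \<open>m\<close> accepts \<open>r (m, i, a, c)\<close>
  itself, and from then on lists the range of \<open>\<lambda>n. \<phi>\<^sub>a (c, n)\<close>.\<close>

lemma switching_program:
  "\<exists>r. recursive (\<lambda>p z. r z) \<and>
    (\<forall>m i a c n. let e = r (prod_encode (m, prod_encode (i, prod_encode (a, c)))) in
       phi e n = (if halted m e n then phi a (prod_encode (c, snd (prod_decode n))) else phi i n))"
proof -
  \<comment> \<open>After acceptance only the second component of \<open>n\<close> is used, so each
    entry of the list recurs at arbitrarily late positions and none is lost by the delay.\<close>
  define H where "H = (\<lambda>x.
    let e = fst (prod_decode x); z = fst (prod_decode (snd (prod_decode x)));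
        n = snd (prod_decode (snd (prod_decode x))); m = fst (prod_decode z);
        i = fst (prod_decode (snd (prod_decode z)));
        a = fst (prod_decode (snd (prod_decode (snd (prod_decode z)))));
        c = snd (prod_decode (snd (prod_decode (snd (prod_decode z)))))
    in if halted m e n then prod_encode (a, prod_encode (c, snd (prod_decode n)))
       else prod_encode (i, n))"
  have "recursive (\<lambda>p x. H x)"
    unfolding H_def Let_def by (intro recursive_intros)
  from recursion_theorem[OF this] obtain r where r: "recursive (\<lambda>p z. r z)"
    "\<And>z n. phi (r z) n =
      (case prod_decode (H (prod_encode (r z, prod_encode (z, n)))) of (e, l) \<Rightarrow> phi e l)" by blast
  have "phi e n = (if halted m e n then phi a (prod_encode (c, snd (prod_decode n))) else phi i n)"
    if "e = r (prod_encode (m, prod_encode (i, prod_encode (a, c))))" for e m i a c n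
    unfolding that by (subst r(2)) (simp add: H_def)
  with r(1) show ?thesis unfolding Let_def by blast
qed

section \<open>Program lengths and bounds on \<open>K\<close>\<close>

text \<open>The separator is the last bit, so the extra input is the empty string, with code
  0.\<close>

lemma run_string_self_delimiting:
  "run_string (replicate i False @ [True]) n = phi i (prod_encode (0, n))"
proof -
  have "dropWhile Not (replicate i False @ [True]) = [True]" by (induction i) simp_all
  moreover have "takeWhile Not (replicate i False @ [True]) = replicate i False"
    by (induction i) simp_all
  ultimately show ?thesis by (simp add: run_string_def)
qed

text \<open>Composing program \<open>e\<close> with \<open>CSnd\<close>, whose code is 3, discards
  the extra input. The resulting machine has index \<open>4 * prod_encode (e, 3) + 6\<close>; the
  separator bit adds one more.\<close>

definition K_bound :: "nat \<Rightarrow> nat" where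
  "K_bound e = 4 * prod_encode (e, 3) + 7"

lemma K_bound_program:
  assumes "\<And>n. phi e n = Some (p n)" "type2_name B p x"
  shows "\<exists>s p. length s = K_bound e \<and> (\<forall>n. run_string s n = Some (p n)) \<and> type2_name B p x"
proof -
  define s where "s = replicate (4 * prod_encode (e, 3) + 6) False @ [True]"
  have "phi (4 * prod_encode (e, 3) + 6) (prod_encode (0, n)) = phi e n" for n
    unfolding phi_def Phi_def prog_of_compound by (simp add: prog_of.simps[of 3])
  then have "run_string s n = Some (p n)" for n
    unfolding s_def run_string_self_delimiting by (simp add: assms(1))
  moreover have "length s = K_bound e" by (simp add: s_def K_bound_def)
  ultimately show ?thesis using assms(2) by blast
qed

lemma K_le_K_bound: "K B x \<le> K_bound e" if "markov_name B e x"
proof -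
  from that obtain p where "\<And>n. phi e n = Some (p n)" "type2_name B p x"
    unfolding markov_name_def by blast
  from K_bound_program[OF this] show ?thesis unfolding K_def by (rule Least_le)
qed

lemma string_code_bound: "string_code s + 2 \<le> 2 ^ Suc (length s)"
  by (induction s) auto

text \<open>A shortest program has length at most \<open>k\<close>, which bounds both its unary
  machine index and the code of its extra input. The programs to be considered thus lie in an
  explicit finite family of pairs \<open>(a, c)\<close>.\<close>

lemma K_name_program:
  assumes "x \<in> computable_points T B" "K_name B (k, p) x"
  shows "\<exists>a\<le>k. \<exists>c\<le>2 ^ k. \<exists>q. (\<forall>n. phi a (prod_encode (c, n)) = Some (q n)) \<and> type2_name B q x"
proof -
  from assms(1) obtain e p' where "\<And>n. phi e n = Some (p' n)" "type2_name B p' x"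
    unfolding computable_points_def total_computable_def by blast
  from K_bound_program[OF this]
  have "\<exists>l s p. length s = l \<and> (\<forall>n. run_string s n = Some (p n)) \<and> type2_name B p x" by blast
  then have "\<exists>s p. length s = K B x \<and> (\<forall>n. run_string s n = Some (p n)) \<and> type2_name B p x"
    unfolding K_def by (rule LeastI_ex)
  then obtain s q where s: "length s = K B x" "\<And>n. run_string s n = Some (q n)" "type2_name B q x"
    by blast
  \<comment> \<open>A string without separator would give no output at 0; \<open>b\<close> is the
    separator and \<open>t\<close> the extra input.\<close>
  from s(2)[of 0] obtain b t where t: "dropWhile Not s = b # t"
    by (auto simp: run_string_def split: list.splits)
  have len: "length s = length (takeWhile Not s) + length (dropWhile Not s)"
    by (metis length_append takeWhile_dropWhile_id)
  have "length s \<le> k" using s(1) assms(2) by (simp add: K_name_def)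
  then have le: "length (takeWhile Not s) \<le> k" "Suc (length t) \<le> k" using len t by auto
  have "string_code t + 2 \<le> 2 ^ Suc (length t)" by (rule string_code_bound)
  also have "\<dots> \<le> 2 ^ k" using le(2) by (intro power_increasing) auto
  finally have "string_code t \<le> 2 ^ k" by simp
  moreover have "phi (length (takeWhile Not s)) (prod_encode (string_code t, n)) = Some (q n)" for n
    using s(2)[of n] by (simp add: run_string_def t)
  ultimately show ?thesis using le(1) s(3) by blast
qed

section \<open>The two uniform translations\<close>

lemma markov_imp_K_semidecides_uniformly:
  "\<exists>f. total_computable f \<and>
    (\<forall>(T :: 'a topology) B A m. markov_semidecides T B m A \<longrightarrow> K_semidecides T B (f m) A)"
proof -
  obtain r where r: "recursive (\<lambda>p z. r z)"
    and phi_r: "\<And>m i a c n. let e = r (prod_encode (m, prod_encode (i, prod_encode (a, c)))) in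
       phi e n = (if halted m e n then phi a (prod_encode (c, snd (prod_decode n))) else phi i n)"
    using switching_program by blast
  define e where "e = (\<lambda>m i a c. r (prod_encode (m, prod_encode (i, prod_encode (a, c)))))"
  have phi_e: "phi (e m i a c) n = (if halted m (e m i a c) n
      then phi a (prod_encode (c, snd (prod_decode n))) else phi i n)" for m i a c n
    using phi_r unfolding e_def Let_def by blast
  \<comment> \<open>Here \<open>i\<close> is the guessed program and \<open>t\<close> a common
    acceptance time for the whole family. The bound \<open>s\<close> limits the certificates for the
    copied values and the positions where \<open>p\<close> lists them.\<close>
  define P where "P = (\<lambda>p m k i t s. (\<forall>a\<le>k. \<forall>c\<le>2 ^ k. halted m (e m i a c) t) \<and>
    (\<forall>l<t. \<exists>D\<le>s. \<exists>j\<le>s. proves D i l (p j)))"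
  have "decidable (\<lambda>p x. P p (fst (prod_decode (fst (prod_decode x))))
      (snd (prod_decode (fst (prod_decode x)))) (fst (prod_decode (snd (prod_decode x))))
      (fst (prod_decode (snd (prod_decode (snd (prod_decode x))))))
      (snd (prod_decode (snd (prod_decode (snd (prod_decode x)))))))"
    unfolding P_def e_def by (intro recursive_intros recursive_compose[OF r])
  from uniform_semidecision[OF this] obtain f where f: "total_computable f"
    "\<And>p m k. Phi p (f m) k \<noteq> None \<longleftrightarrow> (\<exists>w. P p m k (fst (prod_decode w))
      (fst (prod_decode (snd (prod_decode w)))) (snd (prod_decode (snd (prod_decode w)))))"
    unfolding prod_encode_inverse fst_conv snd_conv by blast
  have f_iff: "Phi p (f m) k \<noteq> None \<longleftrightarrow> (\<exists>i t s. P p m k i t s)" for p m k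
    unfolding f(2) by (metis fst_conv snd_conv prod_encode_inverse)
  have "Phi p (f m) k \<noteq> None \<longleftrightarrow> x \<in> A"
    if semi: "markov_semidecides T B m A" and x: "x \<in> computable_points T B"
      and kp: "K_name B (k, p) x" for T :: "'a topology" and B A m x k p
    unfolding f_iff
  proof
    have accept: "phi m i \<noteq> None \<longleftrightarrow> x \<in> A" if "markov_name B i x" for i
      using semi x that unfolding markov_semidecides_def by blast
    have p: "range p = {i. x \<in> B i}" using kp by (simp add: K_name_def type2_name_def)
    show "x \<in> A" if "\<exists>i t s. P p m k i t s"
    proof -
      from that obtain i t s where P: "P p m k i t s" by blast
      \<comment> \<open>Some pair in the family names \<open>x\<close>; the search covers all pairs
        and need not know which one does.\<close>
      from K_name_program[OF x kp] obtain a c q where ac: "a \<le> k" "c \<le> 2 ^ k"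
        and q: "\<And>n. phi a (prod_encode (c, n)) = Some (q n)" "range q = {i. x \<in> B i}"
        unfolding type2_name_def by blast
      let ?e = "e m i a c"
      from P ac have halt: "halted m ?e t" unfolding P_def by blast
      have prefix: "\<exists>j. phi i l = Some (p j)" if "l < t" for l
        using P that unfolding P_def by (blast dest: proves_sound)
      \<comment> \<open>After acceptance the values come from the name \<open>q\<close>; before it
        the position is below \<open>t\<close>, where the copied values are known to be listed by
        \<open>p\<close>.\<close>
      have val: "\<exists>v. phi ?e n = Some v \<and> x \<in> B v" for n
      proof (cases "halted m ?e n")
        case True
        then show ?thesis using phi_e q by auto
      next
        case False
        then have "n < t" using halt halted_mono not_less by blast
        then show ?thesis using prefix[of n] False phi_e p by auto
      qed
      then obtain g where g: "\<And>n. phi ?e n = Some (g n)" "\<And>n. x \<in> B (g n)" by metis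
      have "v \<in> range g" if "x \<in> B v" for v
      proof -
        from that q(2) obtain n where n: "v = q n" by blast
        \<comment> \<open>Position \<open>prod_encode (t, n)\<close> is late enough for the switch
          to have happened, and its second component selects entry \<open>n\<close> of
          \<open>q\<close>.\<close>
        have "t \<le> prod_encode (t, n)" by (rule le_prod_encode_1)
        with halt have "halted m ?e (prod_encode (t, n))" by (rule halted_mono)
        then have "phi ?e (prod_encode (t, n)) = Some v" using phi_e q(1) n by simp
        with g(1) show ?thesis by (metis option.inject rangeI)
      qed
      then have "range g = {i. x \<in> B i}" using g(2) by blast
      with g(1) have "markov_name B ?e x" unfolding markov_name_def type2_name_def by blast
      with accept halt halted_iff show ?thesis by blast
    qed
    show "\<exists>i t s. P p m k i t s" if "x \<in> A"
    proof -
      from x obtain i q where i: "\<And>n. phi i n = Some (q n)" and q: "range q = {i. x \<in> B i}"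
        unfolding computable_points_def total_computable_def type2_name_def by blast
      \<comment> \<open>Self-reference at work: a program that is never accepted copies
        \<open>i\<close> forever and so names \<open>x\<close>, which forces acceptance. Nothing is
        assumed about \<open>a\<close> and \<open>c\<close>.\<close>
      have halts: "\<exists>t. halted m (e m i a c) t" for a c
      proof (rule ccontr)
        assume never: "\<not> ?thesis"
        then have "phi (e m i a c) n = Some (q n)" for n using phi_e i by simp
        with q have "markov_name B (e m i a c) x"
          unfolding markov_name_def type2_name_def by blast
        with accept \<open>x \<in> A\<close> never halted_iff show False by blast
      qed
      have "\<exists>t. \<forall>a\<le>k. \<forall>c\<le>2 ^ k. halted m (e m i a c) t"
        by (intro uniform_bound_le halts) (blast intro: halted_mono)+
      then obtain t where t: "\<forall>a\<le>k. \<forall>c\<le>2 ^ k. halted m (e m i a c) t" ..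
      \<comment> \<open>Both \<open>p\<close> and \<open>q\<close> list the basic neighbourhoods of
        \<open>x\<close>, so each copied value appears in \<open>p\<close>; finitely many positions
        and certificates have a common bound.\<close>
      have "\<exists>s. \<forall>l\<le>t. \<exists>D\<le>s. \<exists>j\<le>s. proves D i l (p j)"
      proof (rule uniform_bound_le)
        fix l
        have "q l \<in> range p" using p q by blast
        then obtain j where "phi i l = Some (p j)" using i by auto
        then obtain D where "proves D i l (p j)" using proves_iff by blast
        then have "\<exists>D'\<le>max D j. \<exists>j'\<le>max D j. proves D' i l (p j')"
          by (meson max.cobounded1 max.cobounded2)
        then show "\<exists>s. \<exists>D\<le>s. \<exists>j\<le>s. proves D i l (p j)" ..
      next
        fix l s s' :: nat
        assume "\<exists>D\<le>s. \<exists>j\<le>s. proves D i l (p j)" "s \<le> s'"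
        then show "\<exists>D\<le>s'. \<exists>j\<le>s'. proves D i l (p j)" by (meson le_trans)
      qed
      then obtain s where "\<forall>l\<le>t. \<exists>D\<le>s. \<exists>j\<le>s. proves D i l (p j)" ..
      then have "P p m k i t s" using t unfolding P_def by simp
      then show ?thesis by blast
    qed
  qed
  then have "\<forall>(T :: 'a topology) B A m. markov_semidecides T B m A \<longrightarrow> K_semidecides T B (f m) A"
    unfolding K_semidecides_def by blast
  with f(1) show ?thesis by blast
qed

lemma K_imp_markov_semidecides_uniformly:
  "\<exists>g. total_computable g \<and>
    (\<forall>(T :: 'a topology) B A m. K_semidecides T B m A \<longrightarrow> markov_semidecides T B (g m) A)"
proof -
  \<comment> \<open>The oracle is replaced by certified values of program \<open>e\<close>, and
    \<open>K_bound e\<close> is supplied as the bound on \<open>K\<close>, so the search works from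
    \<open>e\<close> alone.\<close>
  define P where "P = (\<lambda>m e E D v. valid E \<and>
    derivation (\<lambda>i w. fact_code e i w \<in> set_decode E) (set_decode D) \<and>
    fact_code m (K_bound e) v \<in> set_decode D)"
  have "decidable (\<lambda>p x. P (fst (prod_decode (fst (prod_decode x))))
      (snd (prod_decode (fst (prod_decode x)))) (fst (prod_decode (snd (prod_decode x))))
      (fst (prod_decode (snd (prod_decode (snd (prod_decode x))))))
      (snd (prod_decode (snd (prod_decode (snd (prod_decode x)))))))"
    unfolding P_def K_bound_def by (intro recursive_intros)
  from uniform_semidecision[OF this] obtain g where g: "total_computable g"
    "\<And>p m e. Phi p (g m) e \<noteq> None \<longleftrightarrow> (\<exists>w. P m e (fst (prod_decode w))
      (fst (prod_decode (snd (prod_decode w)))) (snd (prod_decode (snd (prod_decode w)))))"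
    unfolding prod_encode_inverse fst_conv snd_conv by blast
  have g_iff: "phi (g m) e \<noteq> None \<longleftrightarrow> (\<exists>E D v. P m e E D v)" for m e
    unfolding phi_def g(2) by (metis fst_conv snd_conv prod_encode_inverse)
  have "phi (g m) e \<noteq> None \<longleftrightarrow> x \<in> A"
    if semi: "K_semidecides T B m A" and x: "x \<in> computable_points T B"
      and e: "markov_name B e x" for T :: "'a topology" and B A m x e
  proof -
    from e obtain p where p: "\<And>n. phi e n = Some (p n)" "type2_name B p x"
      unfolding markov_name_def by blast
    have "K_name B (K_bound e, p) x" using K_le_K_bound[OF e] p(2) by (simp add: K_name_def)
    with semi x have "Phi p m (K_bound e) \<noteq> None \<longleftrightarrow> x \<in> A" unfolding K_semidecides_def by blast
    moreover have "Phi p m (K_bound e) \<noteq> None \<longleftrightarrow> (\<exists>E D v. P m e E D v)"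
      unfolding P_def using Phi_iff_derivation[OF p(1), of m "K_bound e"] by auto
    ultimately show ?thesis using g_iff by blast
  qed
  then have "\<forall>(T :: 'a topology) B A m. K_semidecides T B m A \<longrightarrow> markov_semidecides T B (g m) A"
    unfolding markov_semidecides_def by blast
  with g(1) show ?thesis by blast
qed

theorem mainTheorem4:
  fixes T :: "'a topology" and B :: "nat \<Rightarrow> 'a set"
  assumes "effective_topological_space T B"
  shows "(\<forall>A. A \<subseteq> computable_points T B \<longrightarrow>
            (markov_semidecidable T B A \<longleftrightarrow> K_semidecidable T B A)) \<and>
         (\<exists>f. total_computable f \<and>
            (\<forall>A m. A \<subseteq> computable_points T B \<longrightarrow>
               markov_semidecides T B m A \<longrightarrow> K_semidecides T B (f m) A)) \<and>
         (\<exists>g. total_computable g \<and>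
            (\<forall>A m. A \<subseteq> computable_points T B \<longrightarrow>
               K_semidecides T B m A \<longrightarrow> markov_semidecides T B (g m) A))"
proof -
  obtain f where f: "total_computable f"
    "\<And>(T :: 'a topology) B A m. markov_semidecides T B m A \<Longrightarrow> K_semidecides T B (f m) A"
    using markov_imp_K_semidecides_uniformly by blast
  obtain g where g: "total_computable g"
    "\<And>(T :: 'a topology) B A m. K_semidecides T B m A \<Longrightarrow> markov_semidecides T B (g m) A"
    using K_imp_markov_semidecides_uniformly by blast
  have "markov_semidecidable T B A \<longleftrightarrow> K_semidecidable T B A" for A
    unfolding markov_semidecidable_def K_semidecidable_def using f(2) g(2) by blast
  with f g show ?thesis by blast
qed

end
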